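(* Let $G$ be a locally compact abelian group, let $p$ be a non-zero polynomial on $G$ and let $\gamma\in\widehat{G}$. Then (a) $sp_c(\gamma p)=\{\gamma\}$; (b) $sp_w(\gamma p)=\{\gamma\}$ for any weight function $w$ on $G$ such that $p\in L^\infty_w(G)$.
   Context: $G$ is written additively and equipped with Haar measure; functions agreeing almost everywhere are identified. $\widehat{G}$ is the dual group, written multiplicatively, with action $(x,\gamma)=\gamma(x)$. $\hat f(\gamma)=\int_G f(x)(-x,\gamma)\,dx$ and $f^*(x)=\overline{f(-x)}$ for $f\in L^1(G)$. $\Delta_y\varphi(x)=\varphi(x+y)-\varphi(x)$. A polynomial on $G$ of degree $n$ is a continuous function $\varphi:G\to\mathbb{C}$ such that $\Delta_{y_1}\cdots\Delta_{y_{n+1}}\varphi=0$ for all $y_1,\dots,y_{n+1}\in G$ and $\Delta_{y_1}\cdots\Delta_{y_n}\varphi\ne0$ for some $y_1,\dots,y_n\in G$. $L^\infty_{loc}(G)$ is the set of $\varphi:G\to\mathbb{C}$ with $\chi_K\varphi\in L^\infty(G)$ for every compact $K\subset G$. A weight function on $G$ is $w\in L^\infty_{loc}(G)$ with $w(x)\ge1$ and $w(x+y)\le w(x)w(y)$ for all $x,y\in G$. $L^1_w(G)=\{f\in L^1(G):\int_G|f|w\,dx<\infty\}$ and $L^\infty_w(G)=\{\varphi\in L^\infty_{loc}(G):\operatorname{ess\,sup}_{x}|\varphi(x)|/w(x)<\infty\}$. $C_c(G)$ is the space of continuous compactly supported functions $G\to\mathbb{C}$. With $f^**\varphi(x)=\int_G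 f^*(x-y)\varphi(y)\,dy$: for $\varphi\in L^\infty_{loc}(G)$, $sp_c(\varphi)=\{\gamma\in\widehat G:\hat f(\gamma)=0\text{ for all }f\in C_c(G)\text{ with }f^**\varphi=0\}$; for $\varphi\in L^\infty_w(G)$, $sp_w(\varphi)=\{\gamma\in\widehat G:\hat f(\gamma)=0\text{ for all }f\in L^1_w(G)\text{ with }f^**\varphi=0\}$. *)

theory Defs
  imports "HOL-Analysis.Analysis"
begin

text \<open>
  A Haar measure is given as a Radon measure on the Borel sets. Integrals, measurability and
  null sets refer to its completion, so that altering a function on a null set
  changes nothing; a measure \<open>M\<close> below is always a Haar measure.
\<close>

definition haar_measure :: "'a::{topological_ab_group_add, t2_space} measure \<Rightarrow> bool" where
  "haar_measure M \<longleftrightarrow>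
     sets M = sets borel \<and>
     emeasure M UNIV \<noteq> 0 \<and>
     (\<forall>x. \<forall>A\<in>sets borel. emeasure M ((+) x ` A) = emeasure M A) \<and>
     (\<forall>K. compact K \<longrightarrow> emeasure M K < \<infinity>) \<and>
     (\<forall>A\<in>sets borel. emeasure M A = (INF U\<in>{U. open U \<and> A \<subseteq> U}. emeasure M U)) \<and>
     (\<forall>U. open U \<longrightarrow> emeasure M U = (SUP K\<in>{K. compact K \<and> K \<subseteq> U}. emeasure M K))"

definition dual_group :: "('a::topological_ab_group_add \<Rightarrow> complex) set" where
  "dual_group = {\<gamma>. continuous_on UNIV \<gamma> \<and> (\<forall>x. cmod (\<gamma> x) = 1) \<and>
                    (\<forall>x y. \<gamma> (x + y) = \<gamma> x * \<gamma> y)}"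

definition diff_op :: "'a::topological_ab_group_add \<Rightarrow> ('a \<Rightarrow> complex) \<Rightarrow> ('a \<Rightarrow> complex)" where
  "diff_op y \<phi> = (\<lambda>x. \<phi> (x + y) - \<phi> x)"

text \<open>
  \<open>foldr diff_op [y1, ..., yn] \<phi>\<close> is the iterated difference of \<open>\<phi>\<close> by \<open>y1, ..., yn\<close>.
  The zero function has no degree.
\<close>

definition polynomial_of_degree :: "nat \<Rightarrow> ('a::topological_ab_group_add \<Rightarrow> complex) \<Rightarrow> bool" where
  "polynomial_of_degree n \<phi> \<longleftrightarrow>
     continuous_on UNIV \<phi> \<and>
     (\<forall>ys. length ys = n + 1 \<longrightarrow> foldr diff_op ys \<phi> = (\<lambda>_. 0)) \<and>
     (\<exists>ys. length ys = n \<and> foldr diff_op ys \<phi> \<noteq> (\<lambda>_. 0))"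

definition is_polynomial :: "('a::topological_ab_group_add \<Rightarrow> complex) \<Rightarrow> bool" where
  "is_polynomial \<phi> \<longleftrightarrow> (\<exists>n. polynomial_of_degree n \<phi>)"

definition L1 :: "'a measure \<Rightarrow> ('a \<Rightarrow> complex) set" where
  "L1 M = {f. integrable (completion M) f}"

definition Linf :: "'a measure \<Rightarrow> ('a \<Rightarrow> complex) set" where
  "Linf M = {\<phi>. \<phi> \<in> borel_measurable (completion M) \<and>
                (\<exists>C. AE x in completion M. cmod (\<phi> x) \<le> C)}"

definition Linf_loc :: "'a::topological_space measure \<Rightarrow> ('a \<Rightarrow> complex) set" where
  "Linf_loc M = {\<phi>. \<forall>K. compact K \<longrightarrow> (\<lambda>x. indicator K x * \<phi> x) \<in> Linf M}"

definition weight :: "'a::topological_ab_group_add measure \<Rightarrow> ('a \<Rightarrow> real) \<Rightarrow> bool" where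
  "weight M w \<longleftrightarrow> (\<lambda>x. complex_of_real (w x)) \<in> Linf_loc M \<and>
     (\<forall>x. 1 \<le> w x) \<and> (\<forall>x y. w (x + y) \<le> w x * w y)"

definition L1_w :: "'a measure \<Rightarrow> ('a \<Rightarrow> real) \<Rightarrow> ('a \<Rightarrow> complex) set" where
  "L1_w M w = {f \<in> L1 M. integrable (completion M) (\<lambda>x. cmod (f x) * w x)}"

text \<open>
  Finiteness of the essential supremum is expressed by an essential bound. On a group that is not
  \<open>\<sigma>\<close>-compact, \<open>cmod (\<phi> x) / w x\<close> need only be measurable on compact sets, whereas \<open>esssup\<close>
  is infinite by definition for a function that is not measurable.
\<close>

definition Linf_w :: "'a::topological_space measure \<Rightarrow> ('a \<Rightarrow> real) \<Rightarrow> ('a \<Rightarrow> complex) set" where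
  "Linf_w M w = {\<phi> \<in> Linf_loc M. \<exists>C. AE x in completion M. cmod (\<phi> x) / w x \<le> C}"

definition C_c :: "('a::topological_space \<Rightarrow> complex) set" where
  "C_c = {f. continuous_on UNIV f \<and> compact (closure {x. f x \<noteq> 0})}"

definition fourier :: "'a::topological_ab_group_add measure \<Rightarrow> ('a \<Rightarrow> complex) \<Rightarrow> ('a \<Rightarrow> complex) \<Rightarrow> complex" where
  "fourier M f \<gamma> = (\<integral>x. f x * \<gamma> (- x) \<partial>completion M)"

definition star :: "('a::topological_ab_group_add \<Rightarrow> complex) \<Rightarrow> ('a \<Rightarrow> complex)" where
  "star f = (\<lambda>x. cnj (f (- x)))"

definition conv :: "'a::topological_ab_group_add measure \<Rightarrow> ('a \<Rightarrow> complex) \<Rightarrow> ('a \<Rightarrow> complex) \<Rightarrow> ('a \<Rightarrow> complex)" where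
  "conv M f \<phi> = (\<lambda>x. \<integral>y. f (x - y) * \<phi> y \<partial>completion M)"

text \<open>
  The convolutions in the next two definitions are continuous functions (for \<open>\<phi>\<close> in
  \<open>Linf_loc M\<close> and in \<open>Linf_w M w\<close> respectively), so vanishing almost everywhere and
  vanishing everywhere coincide.
\<close>

definition sp_c :: "'a::topological_ab_group_add measure \<Rightarrow> ('a \<Rightarrow> complex) \<Rightarrow> ('a \<Rightarrow> complex) set" where
  "sp_c M \<phi> = {\<gamma> \<in> dual_group. \<forall>f\<in>C_c. conv M (star f) \<phi> = (\<lambda>_. 0) \<longrightarrow> fourier M f \<gamma> = 0}"

definition sp_w :: "'a::topological_ab_group_add measure \<Rightarrow> ('a \<Rightarrow> real) \<Rightarrow> ('a \<Rightarrow> complex) \<Rightarrow> ('a \<Rightarrow> complex) set" where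
  "sp_w M w \<phi> = {\<gamma> \<in> dual_group. \<forall>f\<in>L1_w M w. conv M (star f) \<phi> = (\<lambda>_. 0) \<longrightarrow> fourier M f \<gamma> = 0}"

end

theory Submission
  imports Defs
begin

text \<open>
  Write the convolution at \<open>x\<close> as \<open>\<integral> g z * p (z + x)\<close> with \<open>g = cnj f * \<gamma>\<close>. If it vanishes for all
  \<open>x\<close>, then so do the integrals with \<open>p\<close> replaced by its differences; as those of order equal to the
  degree are constant and not all zero, \<open>\<integral> g = 0\<close>, which says that \<open>fourier M f \<gamma> = 0\<close>.
  Conversely, given a character \<open>\<gamma>' \<noteq> \<gamma>\<close>, let \<open>\<eta> = \<gamma>' / \<gamma>\<close> and choose \<open>y\<close> with \<open>\<eta> y \<noteq> 1\<close>. Let \<open>g\<close> be a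
  difference by \<open>-y\<close>, of order exceeding the degree, of some \<open>h \<in> C_c\<close> with \<open>\<integral> h * \<eta> \<noteq> 0\<close>. Shifting
  the differences onto \<open>p\<close> shows that \<open>g\<close> annihilates the translates of \<open>p\<close>, whereas
  shifting them onto \<open>\<eta>\<close> multiplies \<open>\<integral> h * \<eta>\<close> by a power of \<open>\<eta> y - 1\<close>.
\<close>

section \<open>Haar measure\<close>

lemma haar_sets: "haar_measure M \<Longrightarrow> sets M = sets borel"
  and haar_compact: "haar_measure M \<Longrightarrow> compact K \<Longrightarrow> emeasure M K < \<infinity>"
  and haar_translate: "haar_measure M \<Longrightarrow> A \<in> sets borel \<Longrightarrow> emeasure M ((+) x ` A) = emeasure M A"
  by (simp_all add: haar_measure_def)

lemma haar_space: "haar_measure M \<Longrightarrow> space M = UNIV"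
  using sets_eq_imp_space_eq[OF haar_sets] by simp

lemma measurable_continuous_completion:
  fixes f :: "'a::{topological_ab_group_add, t2_space} \<Rightarrow> 'b::topological_space"
  assumes "haar_measure M" "continuous_on UNIV f"
  shows "f \<in> borel_measurable (completion M)"
  using measurable_completion[of f M borel] borel_measurable_continuous_onI[OF assms(2)]
    measurable_cong_sets[OF haar_sets[OF assms(1)] refl] by blast

lemma borel_measurable_cnj:
  fixes f :: "'a \<Rightarrow> complex"
  assumes "f \<in> borel_measurable N"
  shows "(\<lambda>x. cnj (f x)) \<in> borel_measurable N"
  using assms
  by (rule measurable_compose[OF _ borel_measurable_continuous_onI])
    (intro continuous_on_cnj continuous_on_id)

text \<open>The preimage of a Borel set under translation by \<open>x\<close> is its image under
  translation by \<open>-x\<close>, so this is invariance on Borel sets. The target is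
  \<open>M\<close> and not yet its completion, which is the form from which completed measurability
  is deduced.\<close>

lemma distr_translate_haar:
  fixes M :: "'a::{topological_ab_group_add, t2_space} measure"
  assumes "haar_measure M"
  shows "distr (completion M) M (\<lambda>z. z + x) = M"
proof -
  have c: "continuous_on UNIV (\<lambda>z::'a. z + x)"
    by (intro continuous_intros)
  have m: "(\<lambda>z. z + x) \<in> M \<rightarrow>\<^sub>M M"
    using borel_measurable_continuous_onI[OF c]
      measurable_cong_sets[OF haar_sets[OF assms] haar_sets[OF assms]] by blast
  have "distr M M (\<lambda>z. z + x) = M"
  proof (rule measure_eqI)
    fix A assume "A \<in> sets (distr M M (\<lambda>z. z + x))"
    then have A: "A \<in> sets M" by simp
    have "(\<lambda>z. z + x) -` A = (+) (- x) ` A"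
      by (force simp: image_iff algebra_simps)
    with A show "emeasure (distr M M (\<lambda>z. z + x)) A = emeasure M A"
      using m haar_translate[OF assms, of A "- x"]
      by (simp add: emeasure_distr haar_space[OF assms] haar_sets[OF assms])
  qed simp
  with m show ?thesis by (simp add: distr_completion)
qed

lemma measurable_translate_haar:
  fixes M :: "'a::{topological_ab_group_add, t2_space} measure"
  assumes "haar_measure M"
  shows "(\<lambda>z. z + x) \<in> completion M \<rightarrow>\<^sub>M M"
proof -
  have "continuous_on UNIV (\<lambda>z::'a. z + x)"
    by (intro continuous_intros)
  then show ?thesis
    using measurable_continuous_completion[OF assms]
      measurable_cong_sets[OF refl haar_sets[OF assms]] by blast
qed

text \<open>Continuity gives measurability only against Borel sets. Since the push-forward is
  \<open>M\<close> itself, null sets pull back to null sets, and this extends measurability to the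
  completed sigma-algebra.\<close>

lemma measurable_translate_completion:
  fixes M :: "'a::{topological_ab_group_add, t2_space} measure"
  assumes "haar_measure M"
  shows "(\<lambda>z. z + x) \<in> completion M \<rightarrow>\<^sub>M completion M"
  by (rule completion.measurable_completion2[OF measurable_translate_haar[OF assms]])
    (simp add: distr_translate_haar[OF assms])

lemma distr_translate_completion:
  fixes M :: "'a::{topological_ab_group_add, t2_space} measure"
  assumes "haar_measure M"
  shows "distr (completion M) (completion M) (\<lambda>z. z + x) = completion M"
  by (rule completion.completion_distr_eq[OF measurable_translate_haar[OF assms],
        unfolded distr_translate_haar[OF assms], OF refl, symmetric])

lemma integral_translate_completion:
  fixes M :: "'a::{topological_ab_group_add, t2_space} measure"
    and F :: "'a \<Rightarrow> complex"
  assumes "haar_measure M" "F \<in> borel_measurable (completion M)"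
  shows "(\<integral>z. F (z + x) \<partial>completion M) = (\<integral>z. F z \<partial>completion M)"
proof -
  have "(\<integral>z. F z \<partial>distr (completion M) (completion M) (\<lambda>z. z + x)) = (\<integral>z. F (z + x) \<partial>completion M)"
    by (rule integral_distr[OF measurable_translate_completion[OF assms(1)] assms(2)])
  then show ?thesis
    unfolding distr_translate_completion[OF assms(1)] by (rule sym)
qed

lemma AE_translate_completion:
  fixes M :: "'a::{topological_ab_group_add, t2_space} measure"
  assumes "haar_measure M" "AE z in completion M. P z"
  shows "AE z in completion M. P (z + x)"
proof (rule AE_distrD[OF measurable_translate_completion[OF assms(1)]])
  show "AE z in distr (completion M) (completion M) (\<lambda>z. z + x). P z"
    unfolding distr_translate_completion[OF assms(1)] by (rule assms(2))
qed

text \<open>Inner regularity on the open set \<open>UNIV\<close>: if all compact sets were null, so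
  would be the whole group.\<close>

lemma ex_compact_emeasure_pos:
  fixes M :: "'a::{topological_ab_group_add, t2_space} measure"
  assumes "haar_measure M"
  obtains K where "compact K" "emeasure M K > 0"
proof -
  have "(SUP K\<in>{K. compact K \<and> K \<subseteq> UNIV}. emeasure M K) \<noteq> 0"
    using assms unfolding haar_measure_def by (metis open_UNIV)
  then have "\<exists>K. compact K \<and> emeasure M K \<noteq> 0"
    by (metis (mono_tags, lifting) SUP_bot_conv(2) bot_ennreal mem_Collect_eq)
  then show ?thesis
    using that by (metis zero_less_iff_neq_zero)
qed

section \<open>Continuous functions with compact support\<close>

lemma continuous_on_translate:
  fixes \<phi> :: "'a::topological_ab_group_add \<Rightarrow> 'b::topological_space"
  assumes "continuous_on UNIV \<phi>"
  shows "continuous_on UNIV (\<lambda>z. \<phi> (z + y))"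
  by (rule continuous_on_compose2[OF assms]) (auto intro: continuous_intros)

lemma C_c_cnj: "f \<in> C_c \<Longrightarrow> (\<lambda>x. cnj (f x)) \<in> C_c"
  by (simp add: C_c_def continuous_on_cnj)

lemma C_c_I:
  fixes f :: "'a::t2_space \<Rightarrow> complex"
  assumes "continuous_on UNIV f" "compact K" "\<And>x. x \<notin> K \<Longrightarrow> f x = 0"
  shows "f \<in> C_c"
proof -
  have "closure {x. f x \<noteq> 0} \<subseteq> K"
    using assms by (intro closure_minimal compact_imp_closed) auto
  then have "compact (closure {x. f x \<noteq> 0})"
    using compact_Int_closed[OF assms(2) closed_closure, of "{x. f x \<noteq> 0}"] by (simp add: Int_absorb1)
  with assms show ?thesis by (simp add: C_c_def)
qed

lemma C_c_supportE:
  assumes "f \<in> C_c"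
  obtains K where "compact K" "\<forall>x. x \<notin> K \<longrightarrow> f x = 0"
proof (rule that)
  show "compact (closure {x. f x \<noteq> 0})"
    using assms by (simp add: C_c_def)
  show "\<forall>x. x \<notin> closure {x. f x \<noteq> 0} \<longrightarrow> f x = 0"
    using closure_subset[of "{x. f x \<noteq> 0}"] by blast
qed

lemma C_c_boundedE:
  assumes "f \<in> C_c"
  obtains B where "\<forall>x. cmod (f x) \<le> B"
proof -
  obtain K where K: "compact K" "\<And>x. x \<notin> K \<Longrightarrow> f x = 0"
    using C_c_supportE assms by metis
  have f: "continuous_on UNIV f"
    using assms by (simp add: C_c_def)
  have "compact (f ` K)"
    by (rule compact_continuous_image[OF continuous_on_subset[OF f] K(1)]) simp
  then have "bounded (f ` K)"
    by (rule compact_imp_bounded)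
  then obtain B where "0 < B" "\<forall>y\<in>f ` K. cmod y \<le> B"
    unfolding bounded_pos by blast
  then have "\<forall>x. cmod (f x) \<le> B"
    using K(2) by (metis imageI less_imp_le norm_zero)
  then show thesis by (rule that)
qed

lemma C_c_mult:
  fixes f \<phi> :: "'a::t2_space \<Rightarrow> complex"
  assumes "f \<in> C_c" "continuous_on UNIV \<phi>"
  shows "(\<lambda>x. f x * \<phi> x) \<in> C_c"
proof -
  obtain K where "compact K" "\<And>x. x \<notin> K \<Longrightarrow> f x = 0"
    using C_c_supportE assms(1) by metis
  then show ?thesis
    using assms by (intro C_c_I[of _ K] continuous_intros) (auto simp: C_c_def)
qed

lemma C_c_diff_op:
  fixes f :: "'a::{topological_ab_group_add, t2_space} \<Rightarrow> complex"
  assumes "f \<in> C_c"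
  shows "diff_op y f \<in> C_c"
proof -
  obtain K where K: "compact K" "\<And>x. x \<notin> K \<Longrightarrow> f x = 0"
    using C_c_supportE assms by metis
  have f: "continuous_on UNIV f"
    using assms by (simp add: C_c_def)
  have "compact ((\<lambda>x. x - y) ` K)"
    using K by (intro compact_continuous_image continuous_intros)
  moreover have "f (x + y) = 0" if "x \<notin> (\<lambda>x. x - y) ` K" for x
    using that K(2)[of "x + y"] by (metis add_diff_cancel imageI)
  moreover have "continuous_on UNIV (\<lambda>x. f (x + y) - f x)"
    by (intro continuous_on_diff continuous_on_translate f)
  ultimately show ?thesis
    unfolding diff_op_def using K
    by (intro C_c_I[of _ "K \<union> (\<lambda>x. x - y) ` K"]) auto
qed

lemma C_c_diff_op_funpow:
  fixes f :: "'a::{topological_ab_group_add, t2_space} \<Rightarrow> complex"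
  shows "f \<in> C_c \<Longrightarrow> (diff_op y ^^ k) f \<in> C_c"
  by (induction k) (auto intro: C_c_diff_op)

lemma integrable_C_c:
  fixes M :: "'a::{topological_ab_group_add, t2_space} measure"
  assumes "haar_measure M" "f \<in> C_c"
  shows "integrable (completion M) f"
proof -
  obtain K where K: "compact K" "\<And>x. x \<notin> K \<Longrightarrow> f x = 0"
    using C_c_supportE assms(2) by metis
  obtain B where B: "\<And>x. cmod (f x) \<le> B"
    using C_c_boundedE assms(2) by metis
  have "K \<in> sets M"
    using K haar_sets[OF assms(1)] by (simp add: compact_imp_closed)
  then have "integrable (completion M) (\<lambda>x. B * indicator K x)"
    using haar_compact[OF assms(1) K(1)]
    by (intro integrable_mult_right integrable_real_indicator) auto
  then show ?thesis
  proof (rule Bochner_Integration.integrable_bound)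
    show "f \<in> borel_measurable (completion M)"
      using assms measurable_continuous_completion by (auto simp: C_c_def)
    show "AE x in completion M. norm (f x) \<le> norm (B * indicator K x)"
    proof (rule AE_I2)
      show "norm (f x) \<le> norm (B * indicator K x)" for x
        using B[of x] K(2)[of x] by (cases "x \<in> K") auto
    qed
  qed
qed

text \<open>A weight is essentially bounded on the compact support of \<open>f\<close>. This lets
  the separating functions found in \<open>C_c\<close> serve for \<open>sp_w\<close> as
  well.\<close>

lemma C_c_subset_L1_w:
  fixes M :: "'a::{topological_ab_group_add, t2_space} measure"
  assumes M: "haar_measure M" and w: "weight M w" and f: "f \<in> C_c"
  shows "f \<in> L1_w M w"
proof -
  obtain K where K: "compact K" "\<And>x. x \<notin> K \<Longrightarrow> f x = 0"
    using C_c_supportE f by metis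
  have "(\<lambda>x. indicator K x * complex_of_real (w x)) \<in> Linf M"
    using w K by (simp add: weight_def Linf_loc_def)
  then obtain C where wm: "(\<lambda>x. indicator K x * complex_of_real (w x)) \<in> borel_measurable (completion M)"
    and C: "AE x in completion M. cmod (indicator K x * complex_of_real (w x)) \<le> C"
    unfolding Linf_def by blast
  have fm: "integrable (completion M) f" by (rule integrable_C_c[OF M f])
  \<comment> \<open>As \<open>f\<close> vanishes off \<open>K\<close>, the indicator may be
    inserted. This matters for measurability, since \<open>w\<close> is known to be measurable only
    after restriction to compact sets.\<close>
  have eq: "cmod (f x) * w x = cmod (f x * (indicator K x * complex_of_real (w x)))" for x
  proof -
    have "0 \<le> w x"
      using w unfolding weight_def by (metis order_trans zero_le_one)
    then show ?thesis
      using K(2)[of x] by (cases "x \<in> K") (auto simp: norm_mult)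
  qed
  have "integrable (completion M) (\<lambda>x. C * cmod (f x))"
    using fm by simp
  then have "integrable (completion M) (\<lambda>x. cmod (f x) * w x)"
  proof (rule Bochner_Integration.integrable_bound)
    show "(\<lambda>x. cmod (f x) * w x) \<in> borel_measurable (completion M)"
      unfolding eq
      by (rule measurable_compose[OF borel_measurable_times[OF borel_measurable_integrable[OF fm] wm]
            borel_measurable_norm])
    show "AE x in completion M. norm (cmod (f x) * w x) \<le> norm (C * cmod (f x))"
      using C
    proof eventually_elim
      case (elim x)
      then have "cmod (f x) * cmod (indicator K x * complex_of_real (w x)) \<le> cmod (f x) * C"
        by (intro mult_left_mono) auto
      also have "\<dots> \<le> norm (C * cmod (f x))"
        by (simp add: mult.commute)
      finally show ?case
        unfolding eq by (simp add: norm_mult)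
    qed
  qed
  with fm show ?thesis by (simp add: L1_w_def L1_def)
qed

section \<open>Urysohn functions on locally compact Hausdorff spaces\<close>

lemma locally_compact_space_euclidean:
  assumes "locally compact (UNIV :: 'a::topological_space set)"
  shows "locally_compact_space (euclidean :: 'a topology)"
  unfolding locally_compact_space_def
proof (intro ballI)
  fix x :: 'a
  obtain U V where "open U" "compact V" "x \<in> U" "U \<subseteq> V"
    using locallyE[OF assms, of UNIV x] by (auto simp: openin_open)
  then show "\<exists>U K. openin euclidean U \<and> compactin euclidean K \<and> x \<in> U \<and> U \<subseteq> K"
    by auto
qed

text \<open>Locally compact Hausdorff spaces are completely regular, so \<open>K\<close> can be
  separated from the complement of an open neighbourhood \<open>U\<close> lying in a compact set
  \<open>L\<close>; the resulting function vanishes off \<open>L\<close>.\<close>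

lemma C_c_Urysohn:
  fixes K :: "'a::t2_space set"
  assumes "locally compact (UNIV :: 'a set)" "compact K"
  obtains k :: "'a \<Rightarrow> real"
  where "(\<lambda>x. complex_of_real (k x)) \<in> C_c" "\<And>x. 0 \<le> k x" "\<And>x. x \<in> K \<Longrightarrow> k x = 1"
proof -
  let ?X = "euclidean :: 'a topology"
  have H: "Hausdorff_space ?X"
    using hausdorff unfolding Hausdorff_space_def disjnt_def by (metis open_openin)
  note lc = locally_compact_space_euclidean[OF assms(1)]
  obtain U L where U: "open U" "compact L" "K \<subseteq> U" "U \<subseteq> L"
    using lc assms(2) H locally_compact_space_compact_closed_compact[of ?X] by auto
  have "completely_regular_space ?X"
    using lc H locally_compact_regular_imp_completely_regular_space by blast
  then obtain k where k: "continuous_map ?X (top_of_set {0..1::real}) k"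
    "k ` (- U) \<subseteq> {0}" "k ` K \<subseteq> {1}"
  proof (rule Urysohn_completely_regular_compact_closed[of "0::real" 1 ?X K "- U", rotated])
  qed (use U assms in \<open>auto simp: disjnt_def closed_closedin[symmetric] dest: compact_imp_closed\<close>)
  show thesis
  proof (rule that[of k])
    have "continuous_on UNIV k" "\<And>x. k x \<in> {0..1}"
      using k(1) by (auto simp: continuous_map_in_subtopology)
    moreover have "k x = 0" if "x \<notin> L" for x
      using U(4) k(2) that by blast
    ultimately show "(\<lambda>x. complex_of_real (k x)) \<in> C_c" "\<And>x. 0 \<le> k x"
      using U(2) by (auto intro!: C_c_I[of _ L] continuous_intros)
    show "x \<in> K \<Longrightarrow> k x = 1" for x
      using k by auto
  qed
qed

lemma ex_C_c_integral_nonzero: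
  fixes M :: "'a::{topological_ab_group_add, t2_space} measure"
  assumes "locally compact (UNIV :: 'a set)" and M: "haar_measure M"
  obtains k where "k \<in> C_c" "(\<integral>z. k z \<partial>completion M) \<noteq> 0"
proof -
  obtain K where K: "compact K" "emeasure M K > 0"
    using ex_compact_emeasure_pos[OF M] .
  obtain k where k: "(\<lambda>x. complex_of_real (k x)) \<in> C_c" "\<And>x. 0 \<le> k x" "\<And>x. x \<in> K \<Longrightarrow> k x = 1"
    using C_c_Urysohn[OF assms(1) K(1)] by metis
  have KM: "K \<in> sets M"
    using K haar_sets[OF M] by (simp add: compact_imp_closed)
  have fin: "emeasure M K < \<infinity>"
    by (rule haar_compact[OF M K(1)])
  have "integrable (completion M) k"
    using integrable_C_c[OF M k(1)] by (simp add: complex_of_real_integrable_eq)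
  then have "(\<integral>z. indicator K z \<partial>completion M) \<le> (\<integral>z. k z \<partial>completion M)"
  proof (rule integral_mono[rotated])
    show "integrable (completion M) (\<lambda>z. indicator K z :: real)"
      using KM fin by (intro integrable_real_indicator) auto
    show "indicator K z \<le> k z" for z
      using k by (cases "z \<in> K") auto
  qed
  \<comment> \<open>\<open>measure\<close> sends infinite values to 0, so positivity uses that
    \<open>K\<close> has finite measure.\<close>
  moreover have "measure M K > 0"
    using K fin by (simp add: measure_def enn2real_positive_iff)
  ultimately have "(\<integral>z. k z \<partial>completion M) > 0"
    using KM haar_space[OF M] by simp
  then show thesis
    using that[OF k(1)] by simp
qed

section \<open>Differences and integrals\<close>

text \<open>Iterated differences are linear combinations of translates. Integrability is carried
  through the induction because only then does the integral of a difference split; \<open>x\<close>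
  is arbitrary because the step uses both \<open>x\<close> and \<open>x + y\<close>.\<close>

lemma integral_foldr_diff_op_eq_0:
  fixes p g :: "'a::topological_ab_group_add \<Rightarrow> complex"
  assumes "\<And>x. integrable N (\<lambda>z. g z * p (z + x))" "\<And>x. (\<integral>z. g z * p (z + x) \<partial>N) = 0"
  shows "integrable N (\<lambda>z. g z * foldr diff_op ys p (z + x)) \<and>
    (\<integral>z. g z * foldr diff_op ys p (z + x) \<partial>N) = 0"
proof (induction ys arbitrary: x)
  case Nil
  then show ?case using assms by simp
next
  case (Cons y ys)
  show ?case
    using Cons[of x] Cons[of "x + y"]
    by (simp add: diff_op_def[of y] right_diff_distrib add.assoc)
qed

lemma integral_eq_0_of_annihilates_polynomial:
  fixes p g :: "'a::topological_ab_group_add \<Rightarrow> complex"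
  assumes "is_polynomial p"
    and "\<And>x. integrable N (\<lambda>z. g z * p (z + x))" "\<And>x. (\<integral>z. g z * p (z + x) \<partial>N) = 0"
  shows "(\<integral>z. g z \<partial>N) = 0"
proof -
  obtain n where n: "polynomial_of_degree n p"
    using assms(1) by (auto simp: is_polynomial_def)
  then obtain ys where ys: "length ys = n" "foldr diff_op ys p \<noteq> (\<lambda>_. 0)"
    by (auto simp: polynomial_of_degree_def)
  define q where "q = foldr diff_op ys p"
  \<comment> \<open>One more difference brings the order to \<open>n + 1\<close>, which exceeds the
    degree; hence \<open>q\<close> is constant.\<close>
  have diff_q: "diff_op y q = (\<lambda>_. 0)" for y
  proof -
    have "foldr diff_op (y # ys) p = (\<lambda>_. 0)"
      using n ys(1) unfolding polynomial_of_degree_def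
      by (metis Suc_eq_plus1 length_Cons)
    then show ?thesis by (simp add: q_def)
  qed
  have "q y = q 0" for y
    using fun_cong[OF diff_q[of y], of 0] by (simp add: diff_op_def)
  then have "q = (\<lambda>_. q 0)"
    by (rule ext)
  then obtain c where q: "foldr diff_op ys p = (\<lambda>_. c)"
    unfolding q_def by (rule that)
  with ys(2) have "c \<noteq> 0" by auto
  moreover have "(\<integral>z. g z * c \<partial>N) = 0"
    using integral_foldr_diff_op_eq_0[OF assms(2,3), of ys 0] unfolding q by (rule conjunct2)
  ultimately show ?thesis by simp
qed

section \<open>Moving differences from one factor of an integral to the other\<close>

lemma continuous_on_diff_op:
  "continuous_on UNIV \<phi> \<Longrightarrow> continuous_on UNIV (diff_op y \<phi>)"
  unfolding diff_op_def by (intro continuous_on_diff continuous_on_translate)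

lemma integral_diff_op_by_parts:
  fixes M :: "'a::{topological_ab_group_add, t2_space} measure"
  assumes M: "haar_measure M" and h: "h \<in> C_c" and \<phi>: "continuous_on UNIV \<phi>"
  shows "(\<integral>z. diff_op (- y) h z * \<phi> z \<partial>completion M) = (\<integral>z. h z * diff_op y \<phi> z \<partial>completion M)"
proof -
  have \<phi>': "continuous_on UNIV (\<lambda>z. \<phi> (z + y))"
    by (rule continuous_on_translate[OF \<phi>])
  note i = integrable_C_c[OF M C_c_mult[OF h \<phi>]] integrable_C_c[OF M C_c_mult[OF h \<phi>']]
  \<comment> \<open>Adding \<open>h z * \<phi> z\<close> leaves a single translate of the function
    \<open>h z * \<phi> (z + y)\<close>, to which invariance of the integral applies.\<close>
  have eq: "diff_op (- y) h z * \<phi> z + h z * \<phi> z = h (z + - y) * \<phi> (z + - y + y)" for z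
    by (simp add: diff_op_def algebra_simps)
  have "(\<integral>z. diff_op (- y) h z * \<phi> z \<partial>completion M) + (\<integral>z. h z * \<phi> z \<partial>completion M)
    = (\<integral>z. h (z + - y) * \<phi> (z + - y + y) \<partial>completion M)"
    unfolding eq[symmetric]
    by (intro Bochner_Integration.integral_add[symmetric] i
        integrable_C_c[OF M C_c_mult[OF C_c_diff_op[OF h] \<phi>]])
  also have "\<dots> = (\<integral>z. h z * \<phi> (z + y) \<partial>completion M)"
    using integral_translate_completion[OF M, of "\<lambda>z. h z * \<phi> (z + y)" "- y"] i(2)
    by auto
  finally show ?thesis
    using i by (simp add: diff_op_def[of y] right_diff_distrib algebra_simps)
qed

lemma integral_diff_op_funpow_by_parts:
  fixes M :: "'a::{topological_ab_group_add, t2_space} measure"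
  assumes M: "haar_measure M" and h: "h \<in> C_c" and \<phi>: "continuous_on UNIV \<phi>"
  shows "(\<integral>z. (diff_op (- y) ^^ k) h z * \<phi> z \<partial>completion M)
    = (\<integral>z. h z * (diff_op y ^^ k) \<phi> z \<partial>completion M)"
  using \<phi>
proof (induction k arbitrary: \<phi>)
  case (Suc k)
  then show ?case
    using integral_diff_op_by_parts[OF M C_c_diff_op_funpow[OF h]] Suc.IH[OF continuous_on_diff_op]
    \<comment> \<open>The outermost difference of \<open>h\<close> becomes the innermost one of
      \<phi>, so the powers must be commuted before the induction hypothesis for
      \<open>diff_op y \<phi>\<close> fits.\<close>
    by (simp add: funpow_swap1[of "diff_op y" k \<phi>])
qed simp

lemma diff_op_funpow_translate:
  "(diff_op y ^^ k) (\<lambda>z. p (z + x)) = (\<lambda>z. (diff_op y ^^ k) p (z + x))"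
  by (induction k) (auto simp: diff_op_def add_ac fun_eq_iff)

text \<open>A character is an eigenfunction of \<open>diff_op y\<close> with eigenvalue
  \<open>\<eta> y - 1\<close>.\<close>

lemma diff_op_funpow_character:
  assumes "\<And>z. \<eta> (z + y) = \<eta> z * \<eta> y"
  shows "(diff_op y ^^ k) \<eta> = (\<lambda>z. (\<eta> y - 1) ^ k * \<eta> z)"
  by (induction k) (auto simp: diff_op_def assms fun_eq_iff algebra_simps)

section \<open>Characters and spectra\<close>

lemma dual_group_cnj_mult:
  "\<gamma> \<in> dual_group \<Longrightarrow> cnj (\<gamma> x) * \<gamma> x = 1"
  by (simp add: dual_group_def complex_norm_square[symmetric] mult.commute)

lemma dual_group_nonzero:
  assumes "\<gamma> \<in> dual_group"
  shows "\<gamma> x \<noteq> 0"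
  using dual_group_cnj_mult[OF assms, of x] by auto

lemma dual_group_uminus:
  assumes "\<gamma> \<in> dual_group"
  shows "\<gamma> (- x) = cnj (\<gamma> x)"
proof -
  have add: "\<gamma> (u + v) = \<gamma> u * \<gamma> v" for u v
    using assms by (simp add: dual_group_def)
  have "\<gamma> 0 = 1"
    using add[of 0 0] dual_group_nonzero[OF assms, of 0] by simp
  then have "\<gamma> (- x) * \<gamma> x = cnj (\<gamma> x) * \<gamma> x"
    using add[of "- x" x] dual_group_cnj_mult[OF assms, of x] by simp
  then show ?thesis
    using dual_group_nonzero[OF assms, of x] by simp
qed

text \<open>Expresses the transform through \<open>cnj f * \<gamma>\<close>, the same function that
  appears when the convolution is rewritten.\<close>

lemma fourier_eq_cnj_integral:
  assumes "\<gamma> \<in> dual_group"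
  shows "fourier M f \<gamma> = cnj (\<integral>z. cnj (f z) * \<gamma> z \<partial>completion M)"
  unfolding fourier_def dual_group_uminus[OF assms]
  by (subst Bochner_Integration.integral_cnj[symmetric]) simp

text \<open>Substitute \<open>y = z + x\<close> and split \<open>\<gamma> (z + x)\<close>. Since
  \<open>\<gamma> x\<close> is non-zero, the convolution vanishes exactly when
  \<open>cnj f * \<gamma>\<close> annihilates all translates of \<open>p\<close>.\<close>

lemma conv_star_character_mult:
  fixes M :: "'a::{topological_ab_group_add, t2_space} measure"
  assumes M: "haar_measure M" and \<gamma>: "\<gamma> \<in> dual_group" and p: "continuous_on UNIV p"
    and f: "f \<in> borel_measurable (completion M)"
  shows "conv M (star f) (\<lambda>x. \<gamma> x * p x) x
    = \<gamma> x * (\<integral>z. cnj (f z) * \<gamma> z * p (z + x) \<partial>completion M)"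
proof -
  let ?F = "\<lambda>z. cnj (f z) * (\<gamma> (z + x) * p (z + x))"
  have "continuous_on UNIV \<gamma>"
    using \<gamma> by (simp add: dual_group_def)
  then have "continuous_on UNIV (\<lambda>z. \<gamma> (z + x) * p (z + x))"
    using p by (intro continuous_on_mult continuous_on_translate)
  then have "?F \<in> borel_measurable (completion M)"
    by (intro borel_measurable_times[OF borel_measurable_cnj[OF f]]
        measurable_continuous_completion[OF M])
  from integral_translate_completion[OF M this, of "- x"]
  have "conv M (star f) (\<lambda>x. \<gamma> x * p x) x = (\<integral>z. ?F z \<partial>completion M)"
    by (simp add: conv_def star_def)
  also have "\<dots> = (\<integral>z. \<gamma> x * (cnj (f z) * \<gamma> z * p (z + x)) \<partial>completion M)"
    using \<gamma> by (intro Bochner_Integration.integral_cong) (auto simp: dual_group_def)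
  finally show ?thesis by simp
qed

text \<open>Puts \<gamma> into both spectra. The assumption \<open>int\<close> is met through
  compact support for \<open>sp_c\<close> and through the weight for \<open>sp_w\<close>.\<close>

lemma fourier_eq_0_of_conv_eq_0:
  fixes M :: "'a::{topological_ab_group_add, t2_space} measure"
  assumes M: "haar_measure M" and \<gamma>: "\<gamma> \<in> dual_group" and p: "is_polynomial p"
    and f: "f \<in> borel_measurable (completion M)"
    and int: "\<And>x. integrable (completion M) (\<lambda>z. cnj (f z) * \<gamma> z * p (z + x))"
    and conv: "conv M (star f) (\<lambda>x. \<gamma> x * p x) = (\<lambda>_. 0)"
  shows "fourier M f \<gamma> = 0"
proof -
  have pc: "continuous_on UNIV p"
    using p by (auto simp: is_polynomial_def polynomial_of_degree_def)
  have "(\<integral>z. cnj (f z) * \<gamma> z * p (z + x) \<partial>completion M) = 0" for x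
    using conv_star_character_mult[OF M \<gamma> pc f, of x] dual_group_nonzero[OF \<gamma>, of x] fun_cong[OF conv, of x] by simp
  from integral_eq_0_of_annihilates_polynomial[OF p int this] show ?thesis
    by (simp add: fourier_eq_cnj_integral[OF \<gamma>])
qed

text \<open>The bound of \<open>p\<close> by a multiple of \<open>w\<close> and the
  submultiplicativity of \<open>w\<close> dominate the integrand by a multiple, depending on
  \<open>x\<close>, of \<open>cmod (f z) * w z\<close>.\<close>

lemma integrable_L1_w_mult:
  fixes M :: "'a::{topological_ab_group_add, t2_space} measure"
  assumes M: "haar_measure M" and \<gamma>: "\<gamma> \<in> dual_group" and p: "continuous_on UNIV p"
    and w: "weight M w" and pw: "p \<in> Linf_w M w" and f: "f \<in> L1_w M w"
  shows "integrable (completion M) (\<lambda>z. cnj (f z) * \<gamma> z * p (z + x))"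
proof -
  obtain C where C: "AE z in completion M. cmod (p z) / w z \<le> C"
    using pw by (auto simp: Linf_w_def)
  have w1: "1 \<le> w z" and w2: "w (z + x) \<le> w z * w x" for z
    using w by (auto simp: weight_def)
  have w0: "0 < w z" for z
    using w1[of z] by linarith
  have fm: "f \<in> borel_measurable (completion M)"
    and "integrable (completion M) (\<lambda>z. cmod (f z) * w z)"
    using f by (auto simp: L1_w_def L1_def)
  then have "integrable (completion M) (\<lambda>z. \<bar>C\<bar> * w x * (cmod (f z) * w z))"
    by (intro integrable_mult_right)
  then show ?thesis
  proof (rule Bochner_Integration.integrable_bound)
    have "continuous_on UNIV \<gamma>"
      using \<gamma> by (simp add: dual_group_def)
    moreover have "continuous_on UNIV (\<lambda>z. p (z + x))"
      by (rule continuous_on_translate[OF p])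
    ultimately show "(\<lambda>z. cnj (f z) * \<gamma> z * p (z + x)) \<in> borel_measurable (completion M)"
      by (intro borel_measurable_times[OF borel_measurable_times[OF borel_measurable_cnj[OF fm]]]
          measurable_continuous_completion[OF M])
    show "AE z in completion M. norm (cnj (f z) * \<gamma> z * p (z + x))
        \<le> norm (\<bar>C\<bar> * w x * (cmod (f z) * w z))"
      \<comment> \<open>The bound on \<open>p\<close> holds almost everywhere only, and is needed at
        \<open>z + x\<close>; translates of null sets are null.\<close>
      using AE_translate_completion[OF M C, of x]
    proof eventually_elim
      case (elim z)
      then have "cmod (p (z + x)) \<le> C * w (z + x)"
        using w0 by (simp add: pos_divide_le_eq)
      also have "\<dots> \<le> \<bar>C\<bar> * (w z * w x)"
        using w0[of "z + x"] w2[of z] by (intro mult_mono) auto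
      finally have "cmod (f z) * cmod (p (z + x)) \<le> cmod (f z) * (\<bar>C\<bar> * (w z * w x))"
        by (intro mult_left_mono) auto
      moreover have "cmod (\<gamma> z) = 1"
        using \<gamma> by (simp add: dual_group_def)
      ultimately show ?case
        using w0[of x] w0[of z] by (simp add: norm_mult abs_mult mult_ac)
    qed
  qed
qed

text \<open>Excludes every other character from both spectra at once: a function in
  \<open>C_c\<close> lies in \<open>L1_w M w\<close> for every weight \<open>w\<close>.\<close>

lemma ex_separating_C_c:
  fixes M :: "'a::{topological_ab_group_add, t2_space} measure"
  assumes lc: "locally compact (UNIV :: 'a set)" and M: "haar_measure M"
    and p: "is_polynomial p" and \<gamma>: "\<gamma> \<in> dual_group" and \<gamma>': "\<gamma>' \<in> dual_group" and ne: "\<gamma>' \<noteq> \<gamma>"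
  obtains f where "f \<in> C_c" "conv M (star f) (\<lambda>x. \<gamma> x * p x) = (\<lambda>_. 0)" "fourier M f \<gamma>' \<noteq> 0"
proof -
  obtain n where n: "polynomial_of_degree n p"
    using p by (auto simp: is_polynomial_def)
  have pc: "continuous_on UNIV p"
    using n by (simp add: polynomial_of_degree_def)
  have \<gamma>c: "continuous_on UNIV \<gamma>" "continuous_on UNIV \<gamma>'"
    using \<gamma> \<gamma>' by (auto simp: dual_group_def)
  have norm: "cnj (\<gamma> z) * \<gamma> z = 1" "cnj (\<gamma>' z) * \<gamma>' z = 1" for z
    using dual_group_cnj_mult \<gamma> \<gamma>' by blast+
  \<comment> \<open>The quotient of the two characters, as \<open>cnj (\<gamma> z)\<close> is the
    inverse of \<open>\<gamma> z\<close>.\<close>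
  define \<eta> where "\<eta> = (\<lambda>z. \<gamma>' z * cnj (\<gamma> z))"
  have \<eta>c: "continuous_on UNIV \<eta>"
    unfolding \<eta>_def by (intro continuous_intros \<gamma>c)
  have \<eta>_add: "\<eta> (z + y) = \<eta> z * \<eta> y" for z y
    using \<gamma> \<gamma>' by (simp add: \<eta>_def dual_group_def)
  have \<eta>_norm: "cnj (\<eta> z) * \<eta> z = 1" for z
  proof -
    have "cnj (\<eta> z) * \<eta> z = (cnj (\<gamma>' z) * \<gamma>' z) * (cnj (\<gamma> z) * \<gamma> z)"
      by (simp add: \<eta>_def mult_ac)
    then show ?thesis by (simp add: norm)
  qed
  obtain y where y: "\<eta> y \<noteq> 1"
  proof (rule ccontr)
    assume "\<not> thesis"
    with that have *: "\<eta> z = 1" for z by blast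
    have "\<gamma>' z = \<gamma> z" for z
    proof -
      have "\<gamma>' z = \<eta> z * \<gamma> z"
        using norm(1)[of z] by (simp add: \<eta>_def mult.assoc)
      then show ?thesis using * by simp
    qed
    with ne show False by blast
  qed
  obtain k where k: "k \<in> C_c" "(\<integral>z. k z \<partial>completion M) \<noteq> 0"
    using ex_C_c_integral_nonzero[OF lc M] .
  \<comment> \<open>Chosen so that \<open>h * \<eta>\<close> is \<open>k\<close>, whose integral is
    non-zero.\<close>
  define h where "h = (\<lambda>z. k z * cnj (\<eta> z))"
  have h: "h \<in> C_c"
    unfolding h_def by (intro C_c_mult k continuous_intros \<eta>c)
  \<comment> \<open>\<open>Suc n\<close> differences are enough to kill \<open>p\<close>, which has
    degree \<open>n\<close>.\<close>
  define g where "g = (diff_op (- y) ^^ Suc n) h"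
  have g: "g \<in> C_c"
    unfolding g_def by (rule C_c_diff_op_funpow[OF h])
  \<comment> \<open>Solves \<open>cnj f * \<gamma> = g\<close>, so that the convolution tests
    \<open>g\<close> against translates of \<open>p\<close>, while the transform at
    \<open>\<gamma>'\<close> tests \<open>g\<close> against \<eta>.\<close>
  define f where "f = (\<lambda>z. cnj (g z) * \<gamma> z)"
  have f: "f \<in> C_c"
    unfolding f_def by (intro C_c_mult C_c_cnj g \<gamma>c)
  have fg: "cnj (f z) * \<gamma> z = g z" and fg': "cnj (f z) * \<gamma>' z = g z * \<eta> z" for z
    using norm[of z] by (auto simp: f_def \<eta>_def mult_ac)
  have "conv M (star f) (\<lambda>x. \<gamma> x * p x) x = 0" for x
  proof -
    have "(diff_op y ^^ Suc n) p = foldr diff_op (replicate (Suc n) y) p"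
      by (simp only: foldr_replicate)
    also have "\<dots> = (\<lambda>_. 0)"
      using n unfolding polynomial_of_degree_def by (metis Suc_eq_plus1 length_replicate)
    finally have 0: "(diff_op y ^^ Suc n) (\<lambda>z. p (z + x)) = (\<lambda>_. 0)"
      by (simp only: diff_op_funpow_translate)
    have "continuous_on UNIV (\<lambda>z. p (z + x))"
      by (rule continuous_on_translate[OF pc])
    from integral_diff_op_funpow_by_parts[OF M h this, where k = "Suc n" and y = y]
    have "(\<integral>z. g z * p (z + x) \<partial>completion M) = 0"
      unfolding 0 g_def[symmetric] by simp
    then show ?thesis
      using conv_star_character_mult[OF M \<gamma> pc, of f x] integrable_C_c[OF M f]
      by (auto simp: fg)
  qed
  moreover have "fourier M f \<gamma>' \<noteq> 0"
  proof -
    have hk: "h z * \<eta> z = k z" for z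
      using \<eta>_norm[of z] by (simp add: h_def mult.assoc)
    \<comment> \<open>The differences act on \<eta> as multiplication by
      \<open>(\<eta> y - 1) ^ Suc n\<close>, which is non-zero by the choice of
      \<open>y\<close>.\<close>
    have "(\<integral>z. g z * \<eta> z \<partial>completion M) = (\<integral>z. (\<eta> y - 1) ^ Suc n * k z \<partial>completion M)"
      unfolding g_def integral_diff_op_funpow_by_parts[OF M h \<eta>c]
        diff_op_funpow_character[of \<eta>, OF \<eta>_add] hk[symmetric]
      by (simp only: mult_ac)
    then show ?thesis
      using k y by (simp add: fourier_eq_cnj_integral[OF \<gamma>'] fg')
  qed
  ultimately show thesis
    using that f by blast
qed

theorem corollary3p7:
  fixes M :: "'a::{topological_ab_group_add, t2_space} measure"
    and p \<gamma> :: "'a \<Rightarrow> complex"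
  assumes "locally compact (UNIV :: 'a set)"
    and "haar_measure M"
    and "is_polynomial p" and "p \<noteq> (\<lambda>_. 0)"
    and "\<gamma> \<in> dual_group"
  shows "sp_c M (\<lambda>x. \<gamma> x * p x) = {\<gamma>} \<and>
    (\<forall>w. weight M w \<and> p \<in> Linf_w M w \<longrightarrow> sp_w M w (\<lambda>x. \<gamma> x * p x) = {\<gamma>})"
proof (intro conjI allI impI)
  note M = assms(2) and \<gamma> = assms(5)
  have pc: "continuous_on UNIV p"
    using assms(3) by (auto simp: is_polynomial_def polynomial_of_degree_def)
  have \<gamma>c: "continuous_on UNIV \<gamma>"
    using \<gamma> by (simp add: dual_group_def)
  note separate = ex_separating_C_c[OF assms(1) M assms(3) \<gamma>]
  have int: "integrable (completion M) (\<lambda>z. cnj (f z) * \<gamma> z * p (z + x))" if "f \<in> C_c" for f x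
    by (intro integrable_C_c[OF M] C_c_mult C_c_cnj that \<gamma>c
        continuous_on_translate pc)
  have "fourier M f \<gamma> = 0" if "f \<in> C_c" "conv M (star f) (\<lambda>x. \<gamma> x * p x) = (\<lambda>_. 0)" for f
    by (rule fourier_eq_0_of_conv_eq_0[OF M \<gamma> assms(3) _ int[OF that(1)] that(2)])
      (rule borel_measurable_integrable[OF integrable_C_c[OF M that(1)]])
  then show "sp_c M (\<lambda>x. \<gamma> x * p x) = {\<gamma>}"
    unfolding sp_c_def using \<gamma> separate by blast
  fix w assume "weight M w \<and> p \<in> Linf_w M w"
  then have w: "weight M w" and pw: "p \<in> Linf_w M w" by blast+
  have "fourier M f \<gamma> = 0" if f: "f \<in> L1_w M w" "conv M (star f) (\<lambda>x. \<gamma> x * p x) = (\<lambda>_. 0)" for f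
  proof -
    have "f \<in> borel_measurable (completion M)"
      using f by (auto simp: L1_w_def L1_def)
    then show ?thesis
      by (rule fourier_eq_0_of_conv_eq_0[OF M \<gamma> assms(3) _
            integrable_L1_w_mult[OF M \<gamma> pc w pw f(1)] f(2)])
  qed
  \<comment> \<open>The separating functions are those already used for \<open>sp_c\<close>, now
    regarded as elements of \<open>L1_w M w\<close>.\<close>
  then show "sp_w M w (\<lambda>x. \<gamma> x * p x) = {\<gamma>}"
    unfolding sp_w_def using \<gamma> separate C_c_subset_L1_w[OF M w] by blast
qed

end
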